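(* There exists a nonadaptive randomized algorithm that, given query access to a real-valued array $A$ of length $n$ containing at most $r$ distinct values (where $n$ and the upper bound $r$ are known to the algorithm), and a parameter $\epsilon\in(0,1)$, makes $\tilde{O}(r/\epsilon^3)$ queries and outputs, with probability at least $2/3$, an estimate $\mathsf{est}$ of the length of the longest increasing subsequence of $A$ satisfying $\big|\mathsf{est}-|\mathrm{LIS}(A)|\big|\le\epsilon n$. Moreover, the queries of the algorithm are uniformly and independently distributed over $[n]$.
   Context: The array $A$ is accessed through an oracle which, on query $i\in[n]=\{1,\dots,n\}$, returns $A[i]$. An algorithm is nonadaptive if its queries do not depend on the answers to previous queries. $|\mathrm{LIS}(A)|$ denotes the largest cardinality of a set $\mathcal{L}\subseteq[n]$ with $A[u]\le A[v]$ for all $u<v$ in $\mathcal{L}$ (nondecreasing subsequences). The notation $\tilde{O}(f)$ hides factors polylogarithmic in $r$ and $1/\epsilon$: the number of queries is at most $C\cdot\frac{r}{\epsilon^3}\cdot\log^{k}(2+r/\epsilon)$ for absolute constants $C,k$. *)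

theory Defs
  imports "HOL-Probability.Probability"
begin

text \<open>
  Arrays of length \<open>n\<close> are functions on \<open>nat\<close> of which only the values at the indices
  \<open>{1..n}\<close> matter.
\<close>

definition LIS :: "nat \<Rightarrow> (nat \<Rightarrow> real) \<Rightarrow> nat" where
  "LIS n A = Max (card ` {L. L \<subseteq> {1..n} \<and> (\<forall>u\<in>L. \<forall>v\<in>L. u < v \<longrightarrow> A u \<le> A v)})"

text \<open>
  The law of the query sequence is fixed before any answer is seen, which is what makes the
  algorithm nonadaptive. The output law depends on the array only through the answers to the
  queries that were made; it is again a distribution, so that the algorithm may use additional
  random coins after querying. Queries are counted with multiplicity.
\<close>

datatype nonadaptive_alg =
  Nonadaptive_Alg
    (query_dist: "nat list pmf")
    (output_dist: "nat list \<Rightarrow> real list \<Rightarrow> real pmf")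

definition run_alg :: "nonadaptive_alg \<Rightarrow> (nat \<Rightarrow> real) \<Rightarrow> real pmf" where
  "run_alg alg A = bind_pmf (query_dist alg) (\<lambda>qs. output_dist alg qs (map A qs))"

definition makes_at_most_queries :: "nonadaptive_alg \<Rightarrow> real \<Rightarrow> bool" where
  "makes_at_most_queries alg b \<longleftrightarrow> (\<forall>qs\<in>set_pmf (query_dist alg). real (length qs) \<le> b)"

definition iid_uniform_queries :: "nat \<Rightarrow> nonadaptive_alg \<Rightarrow> bool" where
  "iid_uniform_queries n alg \<longleftrightarrow>
     (\<exists>m. query_dist alg = replicate_pmf m (pmf_of_set {1..n}))"

end

theory Submission
  imports Defs
begin

text \<open>
  The estimate is the longest increasing subsequence of the sample (sorted by position), rescaled
  by \<open>n / m\<close> where \<open>m\<close> is the sample size. A fixed longest increasing subsequence of the array is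
  hit about as often as expected, which bounds the estimate from below. For the upper bound, an
  increasing set is determined up to inclusion by the last position \<open>p v\<close> at which it takes a
  value \<open>\<le> v\<close>, for each of the at most \<open>r\<close> values \<open>v\<close>. Rounding every \<open>p v\<close> down to a multiple of
  \<open>w + 1\<close> with \<open>w\<close> about \<open>\<epsilon> n / (2 r)\<close> puts all increasing sets inside at most
  \<open>(1 + 2 r / \<epsilon>) ^ r\<close> sets, each exceeding the size of a longest increasing subsequence by at most
  \<open>r w\<close>. Hoeffding's inequality and a union bound over these sets show that
  \<open>O (r log (2 + r / \<epsilon>) / \<epsilon>\<^sup>2)\<close> samples suffice.
\<close>

section \<open>Increasing subsequences\<close>

lemma LIS_eq_mono_on: "LIS n A = Max (card ` {L. L \<subseteq> {1..n} \<and> mono_on L A})"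
proof -
  have "(\<forall>u\<in>L. \<forall>v\<in>L. u < v \<longrightarrow> A u \<le> A v) \<longleftrightarrow> mono_on L A" for L
    by (auto simp: mono_on_def le_less)
  then show ?thesis by (simp add: LIS_def)
qed

lemma card_le_LIS: "L \<subseteq> {1..n} \<Longrightarrow> mono_on L A \<Longrightarrow> card L \<le> LIS n A"
  unfolding LIS_eq_mono_on by (intro Max_ge) auto

lemma LIS_witness:
  obtains L where "L \<subseteq> {1..n}" "mono_on L A" "card L = LIS n A"
proof -
  let ?F = "{L. L \<subseteq> {1..n} \<and> mono_on L A}"
  have "Max (card ` ?F) \<in> card ` ?F"
    by (intro Max_in) (auto intro!: exI[of _ "{}"] simp: mono_on_def)
  then show thesis using that unfolding LIS_eq_mono_on by auto
qed

text \<open>Repetitions in the list are counted, so for independent samples this is a sum of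
  independent indicators.\<close>

definition hits :: "'a set \<Rightarrow> 'a list \<Rightarrow> nat" where
  "hits U qs = length (filter (\<lambda>x. x \<in> U) qs)"

lemma hits_conv_card: "hits U qs = card {k. k < length qs \<and> qs ! k \<in> U}"
  unfolding hits_def by (rule length_filter_conv_card)

lemma hits_mono: "U \<subseteq> W \<Longrightarrow> hits U qs \<le> hits W qs"
  unfolding hits_conv_card by (intro card_mono) auto

text \<open>The maximum ranges over sample indices rather than array positions: a position drawn
  several times counts several times, and the strict \<open><\<close> leaves repeated draws
  unconstrained. Only the queries and their answers enter.\<close>

definition sample_LIS :: "nat list \<Rightarrow> real list \<Rightarrow> nat" where
  "sample_LIS qs xs = Max (card ` {L. L \<subseteq> {..<length qs} \<and>
     (\<forall>k\<in>L. \<forall>l\<in>L. qs ! k < qs ! l \<longrightarrow> xs ! k \<le> xs ! l)})"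

lemma hits_le_sample_LIS:
  assumes "mono_on L A"
  shows "hits L qs \<le> sample_LIS qs (map A qs)"
  unfolding sample_LIS_def hits_conv_card
  using assms by (intro Max_ge) (auto simp: mono_on_def)

text \<open>The array positions behind an optimal index set form an increasing set of the array.
  That set depends on the sample, so concentration for one fixed set cannot be applied to it
  directly.\<close>

lemma sample_LIS_witness:
  assumes "set qs \<subseteq> S"
  obtains L where "L \<subseteq> S" "mono_on L A" "sample_LIS qs (map A qs) \<le> hits L qs"
proof -
  let ?F = "{L. L \<subseteq> {..<length qs} \<and>
     (\<forall>k\<in>L. \<forall>l\<in>L. qs ! k < qs ! l \<longrightarrow> map A qs ! k \<le> map A qs ! l)}"
  have "Max (card ` ?F) \<in> card ` ?F"
    by (intro Max_in) (auto intro!: exI[of _ "{}"])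
  then obtain K where K: "K \<in> ?F" "sample_LIS qs (map A qs) = card K"
    unfolding sample_LIS_def by blast
  have "K \<subseteq> {..<length qs}" using K by blast
  then have "(!) qs ` K \<subseteq> S"
    using assms by (auto intro: nth_mem)
  moreover have "mono_on ((!) qs ` K) A"
  proof (rule mono_onI)
    fix x y assume "x \<in> (!) qs ` K" "y \<in> (!) qs ` K" "x \<le> y"
    then obtain k l where kl: "k \<in> K" "l \<in> K" "x = qs ! k" "y = qs ! l" by blast
    show "A x \<le> A y"
    proof (cases "x = y")
      case False
      then have "qs ! k < qs ! l" using kl \<open>x \<le> y\<close> by simp
      then have "map A qs ! k \<le> map A qs ! l" using K(1) kl by blast
      moreover have "k < length qs" "l < length qs" using kl \<open>K \<subseteq> {..<length qs}\<close> by auto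
      ultimately show ?thesis using kl by simp
    qed simp
  qed
  moreover have "card K \<le> hits ((!) qs ` K) qs"
    unfolding hits_conv_card using \<open>K \<subseteq> {..<length qs}\<close> by (intro card_mono) auto
  ultimately show thesis using that K(2) by simp
qed

section \<open>Few sets covering all increasing subsequences\<close>

text \<open>Here \<open>q v\<close> stands for an approximate last position at which a value at most
  \<open>v\<close> is taken; the slack \<open>w\<close> absorbs the rounding of
  \<open>q\<close>.\<close>

definition step_set :: "nat \<Rightarrow> (nat \<Rightarrow> real) \<Rightarrow> nat \<Rightarrow> (real \<Rightarrow> nat) \<Rightarrow> nat set" where
  "step_set n A w q =
     {i\<in>{1..n}. (\<forall>u\<in>A ` {1..n}. u < A i \<longrightarrow> q u < i) \<and> i \<le> q (A i) + w}"

definition step_funs :: "nat \<Rightarrow> (nat \<Rightarrow> real) \<Rightarrow> nat \<Rightarrow> (real \<Rightarrow> nat) set" where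
  "step_funs n A w = A ` {1..n} \<rightarrow>\<^sub>E (\<lambda>j. j * (w + 1)) ` {0..n div (w + 1)}"

lemma finite_step_funs: "finite (step_funs n A w)"
  unfolding step_funs_def by (intro finite_PiE) auto

lemma card_step_funs: "card (step_funs n A w) = (n div (w + 1) + 1) ^ card (A ` {1..n})"
proof -
  have "inj_on (\<lambda>j. j * (w + 1)) {0..n div (w + 1)}"
    by (rule inj_onI) (simp only: mult_cancel2, simp)
  then have "card ((\<lambda>j. j * (w + 1)) ` {0..n div (w + 1)}) = n div (w + 1) + 1"
    by (simp only: card_image) simp
  then show ?thesis
    by (simp only: step_funs_def card_PiE finite_imageI finite_atLeastAtMost prod_constant)
qed

text \<open>The elements with \<open>i \<le> q (A i)\<close> form an increasing set: an inversion
  \<open>i \<le> j\<close>, \<open>A j < A i\<close> would give \<open>j \<le> q (A j) < i\<close>.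
  Every other element lies in the window of length \<open>w\<close> just after \<open>q v\<close>
  for its value \<open>v\<close>.\<close>

lemma card_step_set: "card (step_set n A w q) \<le> LIS n A + card (A ` {1..n}) * w"
proof -
  let ?V = "A ` {1..n}"
  let ?M = "{i \<in> step_set n A w q. i \<le> q (A i)}"
  have "mono_on ?M A"
  proof (rule mono_onI, rule ccontr)
    fix i j assume ij: "i \<in> ?M" "j \<in> ?M" "i \<le> j" "\<not> A i \<le> A j"
    then have "q (A j) < i" by (auto simp: step_set_def)
    with ij show False by auto
  qed
  then have "card ?M \<le> LIS n A"
    by (intro card_le_LIS) (auto simp: step_set_def)
  moreover have "card (\<Union>v\<in>?V. {q v<..q v + w}) \<le> (\<Sum>v\<in>?V. card {q v<..q v + w})"
    by (intro card_UN_le) auto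
  moreover have "card (step_set n A w q) \<le> card (?M \<union> (\<Union>v\<in>?V. {q v<..q v + w}))"
  proof (intro card_mono subsetI)
    fix i assume "i \<in> step_set n A w q"
    moreover from this have "A i \<in> ?V" "i \<le> q (A i) + w" by (auto simp: step_set_def)
    ultimately show "i \<in> ?M \<union> (\<Union>v\<in>?V. {q v<..q v + w})"
      by (cases "i \<le> q (A i)") (blast, intro UnI2 UN_I[of "A i"], auto)
  qed (auto simp: step_set_def)
  moreover have "card (?M \<union> (\<Union>v\<in>?V. {q v<..q v + w})) \<le> card ?M + card (\<Union>v\<in>?V. {q v<..q v + w})"
    by (rule card_Un_le)
  ultimately show ?thesis by simp
qed

lemma mono_on_subset_step_set:
  assumes L: "L \<subseteq> {1..n}" and mono: "mono_on L A"
  obtains q where "q \<in> step_funs n A w" "L \<subseteq> step_set n A w q"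
proof -
  \<comment> \<open>The inserted 0 keeps \<open>Max\<close> defined when no element of
    \<open>L\<close> has value at most \<open>v\<close>; it lies below every position, as positions
    start at 1.\<close>
  define p where "p v = Max (insert 0 {i\<in>L. A i \<le> v})" for v
  define q where "q = restrict (\<lambda>v. p v div (w + 1) * (w + 1)) (A ` {1..n})"
  have fin: "finite L" using L finite_subset by blast
  have p_le: "p v \<le> n" for v
    unfolding p_def using fin L by (subst Max_le_iff) auto
  have "q \<in> step_funs n A w"
    unfolding q_def step_funs_def using p_le by (auto intro!: imageI div_le_mono simp del: mult_Suc_right)
  moreover have "i \<in> step_set n A w q" if i: "i \<in> L" for i
  proof -
    have iV: "A i \<in> A ` {1..n}" using i L by blast
    have "q u < i" if u: "u \<in> A ` {1..n}" "u < A i" for u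
    proof -
      \<comment> \<open>By monotonicity, elements of \<open>L\<close> with value at most
        \<open>u\<close> precede \<open>i\<close>, hence so does the last of them; rounding down
        preserves this.\<close>
      have "j < i" if "j \<in> L" "A j \<le> u" for j
      proof (rule ccontr)
        assume "\<not> j < i"
        then have "A i \<le> A j" using mono i that(1) by (auto simp: mono_on_def)
        then show False using that(2) u(2) by simp
      qed
      moreover have "0 < i" using i L by auto
      ultimately have "p u < i"
        unfolding p_def using fin by (subst Max_less_iff) auto
      moreover have "q u \<le> p u" using u(1) by (simp only: q_def restrict_apply if_True div_times_less_eq_dividend)
      ultimately show ?thesis by simp
    qed
    moreover have "i \<le> p (A i)" unfolding p_def using fin i by (intro Max_ge) auto
    moreover have "p (A i) \<le> q (A i) + w"
    proof -
      have "p (A i) = q (A i) + p (A i) mod (w + 1)"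
        using iV by (simp only: q_def restrict_apply if_True div_mult_mod_eq)
      moreover have "p (A i) mod (w + 1) < w + 1" by (rule mod_less_divisor) simp
      ultimately show ?thesis by linarith
    qed
    ultimately show ?thesis using i L by (auto simp: step_set_def)
  qed
  ultimately show thesis using that by blast
qed

section \<open>Concentration of uniform samples\<close>

lemma map_replicate_pmf: "map_pmf (map f) (replicate_pmf m p) = replicate_pmf m (map_pmf f p)"
proof (induction m)
  case (Suc m)
  show ?case
    unfolding replicate_pmf.simps Suc.IH[symmetric]
    by (simp add: map_pmf_def bind_assoc_pmf bind_return_pmf)
qed simp

text \<open>Membership of each sample in \<open>U\<close> is a Bernoulli trial, and
  \<open>hits U\<close> counts the successes of independent trials.\<close>

lemma map_hits_replicate_pmf:
  assumes S: "finite S" "S \<noteq> {}" and U: "U \<subseteq> S"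
  shows "map_pmf (hits U) (replicate_pmf m (pmf_of_set S)) = binomial_pmf m (card U / card S)"
proof -
  let ?p = "card U / card S"
  have p: "?p \<in> {0..1}"
    using S U by (auto simp: divide_le_eq card_gt_0_iff card_mono)
  have "pmf (map_pmf (\<lambda>x. x \<in> U) (pmf_of_set S)) True = pmf (bernoulli_pmf ?p) True"
    using S U p by (simp add: pmf_map measure_pmf_of_set vimage_def Int_absorb1 flip: Collect_conj_eq)
  then have bern: "map_pmf (\<lambda>x. x \<in> U) (pmf_of_set S) = bernoulli_pmf ?p"
    by (metis (full_types) pmf_eqI pmf_False_conv_True)
  have "hits U = (length \<circ> filter id) \<circ> map (\<lambda>x. x \<in> U)"
    by (auto simp: hits_def fun_eq_iff filter_map o_def)
  then have "map_pmf (hits U) (replicate_pmf m (pmf_of_set S)) =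
      map_pmf (length \<circ> filter id) (map_pmf (map (\<lambda>x. x \<in> U)) (replicate_pmf m (pmf_of_set S)))"
    by (simp add: pmf.map_comp)
  then show ?thesis
    by (simp only: map_replicate_pmf bern binomial_pmf_altdef[OF p])
qed

text \<open>Both tails are Hoeffding's inequality for the binomial law, transferred along
  \<open>hits U\<close>.\<close>

lemma
  fixes \<delta> :: real
  assumes S: "finite S" "S \<noteq> {}" and U: "U \<subseteq> S" and m: "m > 0" and \<delta>: "\<delta> \<ge> 0"
  shows prob_hits_ge: "measure_pmf.prob (replicate_pmf m (pmf_of_set S))
           {qs. real (hits U qs) / m \<ge> card U / card S + \<delta>} \<le> exp (-2 * real m * \<delta>\<^sup>2)"
    and prob_hits_le: "measure_pmf.prob (replicate_pmf m (pmf_of_set S))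
           {qs. real (hits U qs) / m \<le> card U / card S - \<delta>} \<le> exp (-2 * real m * \<delta>\<^sup>2)"
proof -
  interpret binomial_distribution m "card U / card S"
    using S U by unfold_locales (auto simp: divide_le_eq card_gt_0_iff card_mono)
  have *: "measure_pmf.prob (replicate_pmf m (pmf_of_set S)) {qs. P (hits U qs)} =
      measure_pmf.prob (binomial_pmf m (card U / card S)) {x. P x}" for P
    by (simp flip: map_hits_replicate_pmf[OF S U] add: vimage_def)
  show "measure_pmf.prob (replicate_pmf m (pmf_of_set S))
           {qs. real (hits U qs) / m \<ge> card U / card S + \<delta>} \<le> exp (-2 * real m * \<delta>\<^sup>2)"
    using prob_ge'[OF m \<delta>] by (subst *) simp
  show "measure_pmf.prob (replicate_pmf m (pmf_of_set S))
           {qs. real (hits U qs) / m \<le> card U / card S - \<delta>} \<le> exp (-2 * real m * \<delta>\<^sup>2)"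
    using prob_le'[OF m \<delta>] by (subst *) simp
qed

section \<open>The estimator\<close>

text \<open>The constant 8 makes the tail at deviation \<open>\<epsilon> / 2\<close> at most
  \<open>K ^ (-4 r)\<close> with \<open>K = 2 + r / \<epsilon>\<close>, which beats the at most
  \<open>K ^ (2 r)\<close> step functions.\<close>

definition LIS_sample_size :: "nat \<Rightarrow> real \<Rightarrow> nat" where
  "LIS_sample_size r \<epsilon> = nat \<lceil>8 * r * log 2 (2 + r / \<epsilon>) / \<epsilon>\<^sup>2\<rceil>"

definition LIS_alg :: "nat \<Rightarrow> nat \<Rightarrow> real \<Rightarrow> nonadaptive_alg" where
  "LIS_alg n r \<epsilon> = Nonadaptive_Alg
     (replicate_pmf (LIS_sample_size r \<epsilon>) (pmf_of_set {1..n}))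
     (\<lambda>qs xs. return_pmf (n * sample_LIS qs xs / length qs))"

lemma run_LIS_alg:
  "run_alg (LIS_alg n r \<epsilon>) A =
     map_pmf (\<lambda>qs. n * sample_LIS qs (map A qs) / length qs)
       (replicate_pmf (LIS_sample_size r \<epsilon>) (pmf_of_set {1..n}))"
  by (simp add: run_alg_def LIS_alg_def map_pmf_def)

text \<open>One bad event is that a fixed optimal set is hit too rarely; the others, one per step
  function, are that its step set is hit too often. The error \<open>\<delta> * n\<close> comes from
  sampling, the rest from the excess size of the step sets.\<close>

lemma prob_sample_LIS_close:
  fixes A :: "nat \<Rightarrow> real" and \<delta> :: real
  assumes n: "n \<ge> 1" and m: "m > 0" and \<delta>: "\<delta> \<ge> 0"
  shows "measure_pmf.prob (replicate_pmf m (pmf_of_set {1..n}))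
           {qs. \<bar>n * sample_LIS qs (map A qs) / length qs - LIS n A\<bar> \<le> card (A ` {1..n}) * w + \<delta> * n}
         \<ge> 1 - (card (step_funs n A w) + 1) * exp (-2 * real m * \<delta>\<^sup>2)"
proof -
  let ?P = "replicate_pmf m (pmf_of_set {1..n})"
  let ?r = "card (A ` {1..n})"
  let ?Q = "step_funs n A w"
  let ?e = "exp (-2 * real m * \<delta>\<^sup>2)"
  obtain L where L: "L \<subseteq> {1..n}" "mono_on L A" "card L = LIS n A" by (rule LIS_witness)
  define low where "low = {qs. real (hits L qs) / m \<le> card L / card {1..n} - \<delta>}"
  define high where
    "high q = {qs. real (hits (step_set n A w q) qs) / m \<ge> card (step_set n A w q) / card {1..n} + \<delta>}" for q
  have S: "finite {1..n}" "{1..n} \<noteq> {}" using n by auto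
  have U: "step_set n A w q \<subseteq> {1..n}" for q by (auto simp: step_set_def)
  have "measure_pmf.prob ?P (\<Union>q\<in>?Q. high q) \<le> (\<Sum>q\<in>?Q. measure_pmf.prob ?P (high q))"
    by (intro measure_pmf.finite_measure_subadditive_finite finite_step_funs) auto
  also have "\<dots> \<le> (\<Sum>q\<in>?Q. ?e)"
    unfolding high_def by (intro sum_mono prob_hits_ge S U m \<delta>)
  finally have "measure_pmf.prob ?P (\<Union>q\<in>?Q. high q) \<le> card ?Q * ?e" by simp
  moreover have "measure_pmf.prob ?P low \<le> ?e"
    unfolding low_def by (intro prob_hits_le S L m \<delta>)
  ultimately have bad: "measure_pmf.prob ?P (low \<union> (\<Union>q\<in>?Q. high q)) \<le> (card ?Q + 1) * ?e"
    using measure_Un_le[of low "measure_pmf ?P" "\<Union>q\<in>?Q. high q"] by (simp add: algebra_simps)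
  have close: "\<bar>n * sample_LIS qs (map A qs) / length qs - LIS n A\<bar> \<le> ?r * w + \<delta> * n"
    if qs: "qs \<in> set_pmf ?P" and good: "qs \<notin> low \<union> (\<Union>q\<in>?Q. high q)" for qs
  proof -
    define s where "s = real (sample_LIS qs (map A qs))"
    have len: "length qs = m" and set_qs: "set qs \<subseteq> {1..n}"
      using qs S by (auto simp: set_replicate_pmf)
    have "LIS n A / n - \<delta> < hits L qs / m"
      using good L(3) by (simp add: low_def)
    also have "\<dots> \<le> s / m"
      unfolding s_def using hits_le_sample_LIS[OF L(2)] by (intro divide_right_mono) auto
    finally have lower: "LIS n A - \<delta> * n \<le> n * s / m"
      using n by (simp add: field_simps)
    obtain K where K: "K \<subseteq> {1..n}" "mono_on K A" "sample_LIS qs (map A qs) \<le> hits K qs"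
      using set_qs by (rule sample_LIS_witness)
    obtain q where q: "q \<in> ?Q" "K \<subseteq> step_set n A w q"
      using K(1,2) by (rule mono_on_subset_step_set)
    have "s \<le> hits (step_set n A w q) qs"
      unfolding s_def using K(3) hits_mono[OF q(2), of qs] by simp
    then have "s / m \<le> hits (step_set n A w q) qs / m"
      by (intro divide_right_mono) auto
    also have "\<dots> < card (step_set n A w q) / n + \<delta>"
      using good q(1) by (force simp: high_def not_le)
    also have "\<dots> \<le> (real (LIS n A) + ?r * w) / n + \<delta>"
      using card_step_set[of n A w q]
      by (intro add_right_mono divide_right_mono)
         (simp_all only: of_nat_le_iff of_nat_0_le_iff flip: of_nat_add of_nat_mult)
    finally have "n * s / m \<le> LIS n A + ?r * w + \<delta> * n"
      using n by (simp add: field_simps)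
    moreover have "real ?r * w \<ge> 0" "\<delta> * n \<ge> 0" using \<delta> by auto
    ultimately have "\<bar>n * s / m - LIS n A\<bar> \<le> ?r * w + \<delta> * n"
      using lower by linarith
    then show ?thesis by (simp add: s_def len)
  qed
  have "1 - (card ?Q + 1) * ?e \<le> 1 - measure_pmf.prob ?P (low \<union> (\<Union>q\<in>?Q. high q))"
    using bad by simp
  also have "\<dots> = measure_pmf.prob ?P (- (low \<union> (\<Union>q\<in>?Q. high q)))"
    using measure_pmf.prob_compl[of "low \<union> (\<Union>q\<in>?Q. high q)" ?P] by (simp add: Compl_eq_Diff_UNIV)
  \<comment> \<open>\<open>close\<close> is available only for samples in the support, so the events
    are compared almost everywhere.\<close>
  also have "\<dots> \<le> measure_pmf.prob ?P
      {qs. \<bar>n * sample_LIS qs (map A qs) / length qs - LIS n A\<bar> \<le> ?r * w + \<delta> * n}"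
    using close by (intro measure_pmf.finite_measure_mono_AE) (auto simp: AE_measure_pmf_iff simp del: One_nat_def)
  finally show ?thesis .
qed

lemma LIS_sample_size_suffices:
  fixes \<epsilon> :: real
  assumes \<epsilon>: "0 < \<epsilon>" and r: "1 \<le> r" and n: "1 \<le> n" and A: "card (A ` {1..n}) \<le> r"
  shows "(card (step_funs n A (nat \<lfloor>\<epsilon> * n / (2 * r)\<rfloor>)) + 1) *
           exp (-2 * real (LIS_sample_size r \<epsilon>) * (\<epsilon> / 2)\<^sup>2) \<le> 1 / 3"
proof -
  define w where "w = nat \<lfloor>\<epsilon> * n / (2 * r)\<rfloor>"
  define m where "m = LIS_sample_size r \<epsilon>"
  define K where "K = 2 + r / \<epsilon>"
  have K: "K \<ge> 2" using \<epsilon> by (simp add: K_def)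
  \<comment> \<open>The floor is exceeded after adding 1, so the grid of multiples of
    \<open>w + 1\<close> has at most \<open>2 r / \<epsilon> + 1\<close> points.\<close>
  have w: "\<epsilon> * n / (2 * r) \<le> real (w + 1)"
    unfolding w_def by linarith
  have "real (n div (w + 1)) \<le> n / real (w + 1)"
    by (rule of_nat_div_le_of_nat)
  also have "\<dots> \<le> n / (\<epsilon> * n / (2 * r))"
    using w \<epsilon> r n by (intro divide_left_mono mult_pos_pos divide_pos_pos) auto
  also have "\<dots> = 2 * (r / \<epsilon>)" using n \<epsilon> r by (simp add: field_simps)
  \<comment> \<open>Bounding by a pure power of \<open>K\<close> lets the union bound and the
    exponential tail be compared through exponents alone.\<close>
  also have "\<dots> + 1 \<le> K\<^sup>2"
  proof -
    have "2 * x + 1 \<le> (2 + x)\<^sup>2" if "0 \<le> x" for x :: real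
      using that by (simp add: power2_sum)
    from this[of "r / \<epsilon>"] show ?thesis using \<epsilon> by (simp add: K_def)
  qed
  finally have "real (n div (w + 1) + 1) \<le> K\<^sup>2" by simp
  then have "real (n div (w + 1) + 1) ^ card (A ` {1..n}) \<le> (K\<^sup>2) ^ card (A ` {1..n})"
    by (intro power_mono) auto
  also have "\<dots> \<le> (K\<^sup>2) ^ r" using A K by (intro power_increasing) auto
  finally have Q: "card (step_funs n A w) \<le> K ^ (2 * r)"
    by (simp add: card_step_funs flip: power_mult)

  have "8 * r * log 2 K / \<epsilon>\<^sup>2 \<le> m"
    unfolding m_def LIS_sample_size_def K_def by linarith
  then have "8 * r * log 2 K \<le> m * \<epsilon>\<^sup>2"
    using \<epsilon> by (simp add: pos_divide_le_eq)
  then have m: "4 * r * log 2 K \<le> 2 * m * (\<epsilon> / 2)\<^sup>2"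
    by (simp add: power_divide)
  have "ln K \<le> log 2 K"
  proof -
    have "ln 2 \<le> (1::real)" using ln_2_less_1 by simp
    moreover have "0 \<le> ln K" using K by simp
    ultimately have "ln K * ln 2 \<le> ln K * 1" by (intro mult_left_mono)
    then show ?thesis by (simp add: log_def pos_le_divide_eq)
  qed
  then have "4 * r * ln K \<le> 2 * m * (\<epsilon> / 2)\<^sup>2"
    using m mult_left_mono[of "ln K" "log 2 K" "4 * real r"] by simp
  then have "exp (- 2 * real m * (\<epsilon> / 2)\<^sup>2) \<le> exp (- (real (4 * r) * ln K))" by simp
  also have "\<dots> = inverse (K ^ (4 * r))"
    using K by (simp only: exp_minus exp_of_nat_mult exp_ln)
  finally have "(card (step_funs n A w) + 1) * exp (- 2 * real m * (\<epsilon> / 2)\<^sup>2)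
      \<le> (K ^ (2 * r) + 1) * inverse (K ^ (4 * r))"
    using Q K by (intro mult_mono) auto
  \<comment> \<open>The product is \<open>x + x\<^sup>2\<close> with \<open>x = K ^ (-2 r)\<close>,
    and \<open>x \<le> 1 / 4\<close> because \<open>K \<ge> 2\<close> and
    \<open>r \<ge> 1\<close>.\<close>
  also have "\<dots> = inverse (K ^ (2 * r)) + (inverse (K ^ (2 * r)))\<^sup>2"
  proof -
    have "K ^ (4 * r) = (K ^ (2 * r))\<^sup>2" by (simp flip: power_mult)
    then show ?thesis using K by (simp add: field_simps power2_eq_square)
  qed
  also have "\<dots> \<le> 1 / 4 + (1 / 4)\<^sup>2"
  proof -
    have "(2::real)\<^sup>2 \<le> K\<^sup>2" using K by (intro power_mono) auto
    also have "\<dots> \<le> K ^ (2 * r)" using K r by (intro power_increasing) auto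
    finally have "inverse (K ^ (2 * r)) \<le> inverse 4" by (intro le_imp_inverse_le) auto
    then show ?thesis using K by (intro add_mono power_mono) auto
  qed
  also have "\<dots> \<le> (1 / 3 :: real)" by (simp add: power2_eq_square)
  finally show ?thesis by (simp add: w_def m_def)
qed

text \<open>The size is of order \<open>1 / \<epsilon>\<^sup>2\<close> and is weakened to
  \<open>1 / \<epsilon> ^ 3\<close>. The constant is 8 plus 1 for the ceiling, absorbed since the
  bounding product is at least 1 once \<open>r \<ge> 1\<close>; for \<open>r = 0\<close> both sides
  vanish.\<close>

lemma LIS_sample_size_le:
  assumes "0 < \<epsilon>" "\<epsilon> < 1"
  shows "real (LIS_sample_size r \<epsilon>) \<le> 9 * (r / \<epsilon> ^ 3) * log 2 (2 + r / \<epsilon>)"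
proof (cases "r = 0")
  case True
  then show ?thesis by (simp add: LIS_sample_size_def)
next
  case False
  let ?l = "log 2 (2 + r / \<epsilon>)"
  have l: "1 \<le> ?l" using assms by (subst le_log_iff) (auto intro: add_pos_nonneg)
  have pow: "1 / \<epsilon>\<^sup>2 \<le> 1 / \<epsilon> ^ 3" "1 \<le> 1 / \<epsilon> ^ 3"
    using assms by (auto intro!: divide_left_mono power_decreasing power_le_one)
  have "1 \<le> r * ?l"
    using mult_mono[of 1 "real r" 1 ?l] False l by simp
  then have "1 \<le> 1 / \<epsilon> ^ 3 * (r * ?l)"
    using mult_mono[of 1 "1 / \<epsilon> ^ 3" 1 "r * ?l"] pow assms by simp
  moreover have "1 / \<epsilon>\<^sup>2 * (r * ?l) \<le> 1 / \<epsilon> ^ 3 * (r * ?l)"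
    using pow l by (intro mult_right_mono) auto
  moreover have "real (LIS_sample_size r \<epsilon>) \<le> 8 * (1 / \<epsilon>\<^sup>2 * (r * ?l)) + 1"
  proof -
    have "0 \<le> 8 * r * ?l / \<epsilon>\<^sup>2" using l by simp
    then have "real (LIS_sample_size r \<epsilon>) \<le> 8 * r * ?l / \<epsilon>\<^sup>2 + 1"
      unfolding LIS_sample_size_def by linarith
    then show ?thesis by simp
  qed
  ultimately have "real (LIS_sample_size r \<epsilon>) \<le> 9 * (1 / \<epsilon> ^ 3 * (r * ?l))" by linarith
  then show ?thesis by simp
qed

text \<open>The error budget is split evenly: rounding costs at most
  \<open>r * w \<le> \<epsilon> / 2 * n\<close>, and sampling gets
  \<open>\<delta> = \<epsilon> / 2\<close>.\<close>

lemma prob_LIS_alg: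
  fixes \<epsilon> :: real
  assumes n: "1 \<le> n" and \<epsilon>: "0 < \<epsilon>" and A: "card (A ` {1..n}) \<le> r"
  shows "measure_pmf.prob (run_alg (LIS_alg n r \<epsilon>) A)
           {est. \<bar>est - real (LIS n A)\<bar> \<le> \<epsilon> * real n} \<ge> 2 / 3"
proof -
  have "card (A ` {1..n}) > 0" using n by (simp add: card_gt_0_iff)
  then have r: "1 \<le> r" using A by simp
  define m where "m = LIS_sample_size r \<epsilon>"
  define w where "w = nat \<lfloor>\<epsilon> * n / (2 * r)\<rfloor>"
  have "log 2 (2 + r / \<epsilon>) > 0" using \<epsilon> by (simp add: add_pos_nonneg)
  then have m: "m > 0" using r \<epsilon> by (simp add: m_def LIS_sample_size_def)
  have "0 \<le> \<epsilon> * n / (2 * r)" using \<epsilon> by simp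
  then have "real w \<le> \<epsilon> * n / (2 * r)" unfolding w_def by linarith
  then have "r * w \<le> \<epsilon> / 2 * n" using r by (simp add: field_simps)
  moreover have "real (card (A ` {1..n})) * w \<le> real r * w"
    using A by (intro mult_right_mono) auto
  ultimately have w: "card (A ` {1..n}) * w + \<epsilon> / 2 * n \<le> \<epsilon> * n" by simp
  have "2 / 3 \<le> 1 - (card (step_funs n A w) + 1) * exp (-2 * real m * (\<epsilon> / 2)\<^sup>2)"
    using LIS_sample_size_suffices[OF \<epsilon> r n A] by (simp add: m_def w_def)
  also have "\<dots> \<le> measure_pmf.prob (replicate_pmf m (pmf_of_set {1..n}))
      {qs. \<bar>n * sample_LIS qs (map A qs) / length qs - LIS n A\<bar> \<le> card (A ` {1..n}) * w + \<epsilon> / 2 * n}"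
    using prob_sample_LIS_close[OF n m, of "\<epsilon> / 2" A w] \<epsilon> by simp
  also have "\<dots> \<le> measure_pmf.prob (replicate_pmf m (pmf_of_set {1..n}))
      {qs. \<bar>n * sample_LIS qs (map A qs) / length qs - LIS n A\<bar> \<le> \<epsilon> * n}"
    using w by (intro measure_pmf.finite_measure_mono) auto
  finally show ?thesis
    by (simp add: run_LIS_alg m_def vimage_def)
qed

theorem theorem1p4:
  "\<exists>(C::real) (k::nat) (alg :: nat \<Rightarrow> nat \<Rightarrow> real \<Rightarrow> nonadaptive_alg).
     \<forall>(n::nat) (r::nat) (\<epsilon>::real). 1 \<le> n \<and> 0 < \<epsilon> \<and> \<epsilon> < 1 \<longrightarrow>
       makes_at_most_queries (alg n r \<epsilon>)
         (C * (real r / \<epsilon> ^ 3) * (log 2 (2 + real r / \<epsilon>)) ^ k) \<and>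
       iid_uniform_queries n (alg n r \<epsilon>) \<and>
       (\<forall>A :: nat \<Rightarrow> real. card (A ` {1..n}) \<le> r \<longrightarrow>
          measure_pmf.prob (run_alg (alg n r \<epsilon>) A)
            {est. \<bar>est - real (LIS n A)\<bar> \<le> \<epsilon> * real n} \<ge> 2 / 3)"
proof (intro exI allI impI, elim conjE, intro conjI allI impI)
  fix n r :: nat and \<epsilon> :: real
  assume n: "1 \<le> n" and \<epsilon>: "0 < \<epsilon>" "\<epsilon> < 1"
  \<comment> \<open>This fixes the witnesses \<open>C = 9\<close> and \<open>k = 1\<close>; the
    explicit exponent 1 matches the required form.\<close>
  show "makes_at_most_queries (LIS_alg n r \<epsilon>)
      (9 * (real r / \<epsilon> ^ 3) * (log 2 (2 + real r / \<epsilon>)) ^ 1)"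
    using LIS_sample_size_le[OF \<epsilon>, of r]
    by (auto simp: makes_at_most_queries_def LIS_alg_def set_replicate_pmf)
  show "iid_uniform_queries n (LIS_alg n r \<epsilon>)"
    by (auto simp: iid_uniform_queries_def LIS_alg_def)
  show "measure_pmf.prob (run_alg (LIS_alg n r \<epsilon>) A)
      {est. \<bar>est - real (LIS n A)\<bar> \<le> \<epsilon> * real n} \<ge> 2 / 3"
    if "card (A ` {1..n}) \<le> r" for A
    using n \<epsilon>(1) that by (rule prob_LIS_alg)
qed

end
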